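(* Consider a Bayesian $M$-ary hypothesis testing problem ($M\ge2$, where $M=\infty$ is allowed) with models $P_i=P_{Y|X=i}$ and prior probabilities $\mathbb{P}[\mathsf{H}_i]=\mathbb{P}[X=i]<1$ for $i\in\{1,\ldots,M\}$. Let $$\overline{\mathbb{P}}[\mathsf{H}_i]=1-\mathbb{P}[\mathsf{H}_i],\qquad \overline{P}_i=\sum_{j\ne i}\frac{\mathbb{P}[\mathsf{H}_j]}{\overline{\mathbb{P}}[\mathsf{H}_i]}\,P_j.$$ Then $$\varepsilon_{X|Y}\le\min_{i\ne k}\ \inf_{\alpha\in(0,1)}\ \overline{\mathbb{P}}^{\,\alpha}[\mathsf{H}_i]\;\overline{\mathbb{P}}^{\,1-\alpha}[\mathsf{H}_k]\;\exp\Bigl((\alpha-1)D_\alpha\bigl(\overline{P}_i\,\big\|\,\overline{P}_k\bigr)\Bigr)$$ (with the minimum over pairs $i\ne k$ read as an infimum if $M=\infty$).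
   Context: Logarithms have an arbitrary fixed base larger than 1 and $\exp$ is the inverse of $\log$ ($\exp(-\infty)=0$). $X$ takes values in $\{1,\ldots,M\}$ (the positive integers if $M=\infty$) and $P_i$ are probability measures on a common measurable space $\mathcal{Y}$; $Y$ has law $P_i$ conditionally on $X=i$. The minimum error probability of guessing $X$ from $Y$ is $\varepsilon_{X|Y}=\min_{\mathcal{L}}\mathbb{P}[X\ne\mathcal{L}(Y)]=1-\mathbb{E}[\max_{m}\mathbb{P}[X=m|Y]]$. For probability measures $P,Q$ with densities $p,q$ with respect to a common dominating measure $R$, the R\'enyi divergence of order $\alpha\in(0,1)$ is $D_\alpha(P\|Q)=\frac{1}{\alpha-1}\log\int p^\alpha q^{1-\alpha}\,\mathrm{d}R$ (equal to $+\infty$ if the integral vanishes). *)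

theory Defs
  imports "HOL-Probability.Probability" "HOL-Library.Extended_Nat"
begin

definition hypotheses :: "enat \<Rightarrow> nat set" where
  "hypotheses M = {i. 1 \<le> i \<and> enat i \<le> M}"

text \<open>The infimum over deterministic decision rules is attained, by maximum a posteriori
  decoding, so it is the minimum.\<close>

definition min_error_prob ::
    "'a measure \<Rightarrow> 'b measure \<Rightarrow> enat \<Rightarrow> ('a \<Rightarrow> nat) \<Rightarrow> ('a \<Rightarrow> 'b) \<Rightarrow> real" where
  "min_error_prob \<Omega> N M X Y =
     (INF L \<in> N \<rightarrow>\<^sub>M count_space (hypotheses M).
        measure \<Omega> {\<omega> \<in> space \<Omega>. X \<omega> \<noteq> L (Y \<omega>)})"

definition prior :: "'a measure \<Rightarrow> ('a \<Rightarrow> nat) \<Rightarrow> nat \<Rightarrow> real" where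
  "prior \<Omega> X i = measure \<Omega> {\<omega> \<in> space \<Omega>. X \<omega> = i}"

definition co_prior :: "'a measure \<Rightarrow> ('a \<Rightarrow> nat) \<Rightarrow> nat \<Rightarrow> real" where
  "co_prior \<Omega> X i = 1 - prior \<Omega> X i"

text \<open>The measure \<open>\<Sum>j\<in>J. w j * P j\<close>; the integral against the counting measure is the
  possibly infinite sum over \<open>J\<close>.\<close>

definition weighted_sum ::
    "'b measure \<Rightarrow> 'i set \<Rightarrow> ('i \<Rightarrow> ennreal) \<Rightarrow> ('i \<Rightarrow> 'b measure) \<Rightarrow> 'b measure" where
  "weighted_sum N J w P =
     measure_of (space N) (sets N) (\<lambda>A. \<integral>\<^sup>+ j. w j * emeasure (P j) A \<partial>count_space J)"

lemma sets_weighted_sum [simp, measurable_cong]: "sets (weighted_sum N J w P) = sets N"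
  by (simp add: weighted_sum_def)

lemma space_weighted_sum [simp]: "space (weighted_sum N J w P) = space N"
  by (simp add: weighted_sum_def)

lemma emeasure_weighted_sum:
  assumes "\<And>j. j \<in> J \<Longrightarrow> sets (P j) = sets N" and "A \<in> sets N"
  shows "emeasure (weighted_sum N J w P) A = (\<integral>\<^sup>+ j. w j * emeasure (P j) A \<partial>count_space J)"
  unfolding weighted_sum_def
proof (rule emeasure_measure_of_sigma)
  show "sigma_algebra (space N) (sets N)"
    by (rule sets.sigma_algebra_axioms)
  show "positive (sets N) (\<lambda>A. \<integral>\<^sup>+ j. w j * emeasure (P j) A \<partial>count_space J)"
    by (simp add: positive_def)
  show "countably_additive (sets N) (\<lambda>A. \<integral>\<^sup>+ j. w j * emeasure (P j) A \<partial>count_space J)"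
  proof (rule countably_additiveI)
    fix A :: "nat \<Rightarrow> 'b set"
    assume A: "range A \<subseteq> sets N" "disjoint_family A"
    have "(\<Sum>n. \<integral>\<^sup>+ j. w j * emeasure (P j) (A n) \<partial>count_space J)
        = (\<integral>\<^sup>+ j. (\<Sum>n. w j * emeasure (P j) (A n)) \<partial>count_space J)"
      by (rule nn_integral_suminf[symmetric]) simp
    also have "\<dots> = (\<integral>\<^sup>+ j. w j * emeasure (P j) (\<Union>n. A n) \<partial>count_space J)"
    proof (rule nn_integral_cong)
      fix j assume "j \<in> space (count_space J)"
      then have "(\<Sum>n. emeasure (P j) (A n)) = emeasure (P j) (\<Union>n. A n)"
        using A assms(1) by (intro suminf_emeasure) auto
      then show "(\<Sum>n. w j * emeasure (P j) (A n)) = w j * emeasure (P j) (\<Union>n. A n)"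
        by simp
    qed
    finally show "(\<Sum>n. \<integral>\<^sup>+ j. w j * emeasure (P j) (A n) \<partial>count_space J)
        = (\<integral>\<^sup>+ j. w j * emeasure (P j) (\<Union>n. A n) \<partial>count_space J)" .
  qed
qed (fact assms(2))

definition co_model ::
    "'a measure \<Rightarrow> 'b measure \<Rightarrow> enat \<Rightarrow> ('a \<Rightarrow> nat) \<Rightarrow> (nat \<Rightarrow> 'b measure) \<Rightarrow> nat \<Rightarrow> 'b measure" where
  "co_model \<Omega> N M X P i =
     weighted_sum N (hypotheses M - {i}) (\<lambda>j. ennreal (prior \<Omega> X j / co_prior \<Omega> X i)) P"

text \<open>The measure \<open>P + Q\<close> serves as the common dominating measure. By \<open>hellinger_integral_eq\<close>
  below, every other choice gives the same value. The integrand is always integrable for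
  \<open>0 < \<alpha> < 1\<close>, so the Bochner integral is the true value of the integral.\<close>

definition measure_plus :: "'b measure \<Rightarrow> 'b measure \<Rightarrow> 'b measure" where
  "measure_plus P Q = weighted_sum P UNIV (\<lambda>_. 1) (\<lambda>b. if b then P else Q)"

definition hellinger_integral :: "real \<Rightarrow> 'b measure \<Rightarrow> 'b measure \<Rightarrow> real" where
  "hellinger_integral \<alpha> P Q =
     (let R = measure_plus P Q in
        (\<integral>y. enn2real (RN_deriv R P y) powr \<alpha> * enn2real (RN_deriv R Q y) powr (1 - \<alpha>) \<partial>R))"

definition renyi_divergence :: "real \<Rightarrow> real \<Rightarrow> 'b measure \<Rightarrow> 'b measure \<Rightarrow> ereal" where
  "renyi_divergence b \<alpha> P Q =
     (if hellinger_integral \<alpha> P Q = 0 then \<infinity>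
      else ereal (1 / (\<alpha> - 1) * log b (hellinger_integral \<alpha> P Q)))"

text \<open>The inverse of the logarithm to base \<open>b > 1\<close>, on the extended reals.\<close>

fun exp_base :: "real \<Rightarrow> ereal \<Rightarrow> ereal" where
  "exp_base b (ereal x) = ereal (b powr x)"
| "exp_base b PInfty = \<infinity>"
| "exp_base b MInfty = 0"

lemma sets_measure_plus [simp, measurable_cong]: "sets (measure_plus P Q) = sets P"
  by (simp add: measure_plus_def)

lemma emeasure_measure_plus:
  assumes "sets P = sets Q" and "A \<in> sets P"
  shows "emeasure (measure_plus P Q) A = emeasure P A + emeasure Q A"
  using assms unfolding measure_plus_def
  by (subst emeasure_weighted_sum)
     (auto simp: nn_integral_count_space_finite UNIV_bool split: if_splits)

lemma finite_measure_measure_plus: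
  assumes "finite_measure P" and "finite_measure Q" and "sets P = sets Q"
  shows "finite_measure (measure_plus P Q)"
proof (rule finite_measureI)
  interpret P: finite_measure P by fact
  interpret Q: finite_measure Q by fact
  have "space (measure_plus P Q) = space P"
    by (simp add: measure_plus_def)
  then show "emeasure (measure_plus P Q) (space (measure_plus P Q)) \<noteq> \<infinity>"
    using emeasure_measure_plus[OF assms(3) sets.top] by simp
qed

lemma density_RN_deriv_measure_plus:
  assumes "finite_measure P" and "finite_measure Q" and "sets P = sets Q"
  shows "density (measure_plus P Q) (RN_deriv (measure_plus P Q) P) = P"
    and "density (measure_plus P Q) (RN_deriv (measure_plus P Q) Q) = Q"
proof -
  interpret S: finite_measure "measure_plus P Q"
    by (rule finite_measure_measure_plus[OF assms])
  have "absolutely_continuous (measure_plus P Q) P" "absolutely_continuous (measure_plus P Q) Q"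
    using assms(3)
    by (auto simp: absolutely_continuous_def null_sets_def emeasure_measure_plus)
  then show "density (measure_plus P Q) (RN_deriv (measure_plus P Q) P) = P"
    and "density (measure_plus P Q) (RN_deriv (measure_plus P Q) Q) = Q"
    using assms(3) by (simp_all add: S.density_RN_deriv)
qed

lemma integrable_of_finite_density:
  fixes p :: "'b \<Rightarrow> real"
  assumes "finite_measure P" and [measurable]: "p \<in> borel_measurable R"
    and nonneg: "\<And>y. 0 \<le> p y" and P: "P = density R p"
  shows "integrable R p"
proof -
  have "integrable P (\<lambda>_. 1 :: real)"
    by (rule finite_measure.integrable_const[OF assms(1)])
  then have "integrable (density R p) (\<lambda>_. 1 :: real)"
    by (simp only: P)
  then show ?thesis
    by (subst (asm) integrable_density) (simp_all add: nonneg)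
qed

lemma hellinger_integrand_integrable:
  fixes p q :: "'b \<Rightarrow> real"
  assumes "finite_measure P" and "finite_measure Q"
    and [measurable]: "p \<in> borel_measurable R" "q \<in> borel_measurable R"
    and "\<And>y. 0 \<le> p y" and "\<And>y. 0 \<le> q y"
    and "P = density R p" and "Q = density R q" and \<alpha>: "0 < \<alpha>" "\<alpha> < 1"
  shows "integrable R (\<lambda>y. p y powr \<alpha> * q y powr (1 - \<alpha>))"
proof (rule Bochner_Integration.integrable_bound)
  have "integrable R p" "integrable R q"
    by (rule integrable_of_finite_density[OF assms(1,3,5,7)],
        rule integrable_of_finite_density[OF assms(2,4,6,8)])
  then show "integrable R (\<lambda>y. p y + q y)"
    by (rule Bochner_Integration.integrable_add)
  have "p y powr \<alpha> * q y powr (1 - \<alpha>) \<le> p y + q y" for y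
  proof -
    have "p y powr \<alpha> * q y powr (1 - \<alpha>)
        \<le> (p y + q y) powr \<alpha> * (p y + q y) powr (1 - \<alpha>)"
      using assms(5,6)[of y] \<alpha> by (intro mult_mono powr_mono2) auto
    also have "\<dots> = p y + q y"
      using assms(5,6)[of y] by (simp flip: powr_add)
    finally show ?thesis .
  qed
  then show "AE y in R. norm (p y powr \<alpha> * q y powr (1 - \<alpha>)) \<le> norm (p y + q y)"
    using assms(5,6) by (auto intro!: AE_I2 simp: add_nonneg_nonneg)
qed simp

lemma hellinger_integral_eq:
  fixes p q :: "'b \<Rightarrow> real"
  assumes "finite_measure P" and "finite_measure Q"
    and [measurable]: "p \<in> borel_measurable R" "q \<in> borel_measurable R"
    and nonneg: "\<And>y. 0 \<le> p y" "\<And>y. 0 \<le> q y"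
    and P: "P = density R p" and Q: "Q = density R q"
  shows "hellinger_integral \<alpha> P Q = (\<integral>y. p y powr \<alpha> * q y powr (1 - \<alpha>) \<partial>R)"
proof -
  define S where "S = measure_plus P Q"
  define p' where "p' = RN_deriv S P"
  define q' where "q' = RN_deriv S Q"
  have setsPQ: "sets P = sets Q" and setsP: "sets P = sets R"
    using P Q by simp_all
  have setsS: "sets S = sets R"
    by (simp add: S_def setsP)
  have S: "S = density R (\<lambda>y. ennreal (p y + q y))"
  proof (rule measure_eqI)
    fix A assume "A \<in> sets S"
    then have A [measurable]: "A \<in> sets R" by (simp add: setsS)
    have "emeasure S A = emeasure P A + emeasure Q A"
      using setsPQ setsP A by (simp add: S_def emeasure_measure_plus)
    also have "\<dots> = emeasure (density R (\<lambda>y. ennreal (p y + q y))) A"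
      using nonneg A
      by (simp add: P Q emeasure_density ennreal_plus distrib_right nn_integral_add)
    finally show "emeasure S A = emeasure (density R (\<lambda>y. ennreal (p y + q y))) A" .
  qed (simp add: setsS)
  have [measurable]: "p' \<in> borel_measurable R" "q' \<in> borel_measurable R"
    using borel_measurable_RN_deriv[of S] setsS
    by (simp_all add: p'_def q'_def cong: measurable_cong_sets)
  have dP: "density S p' = P" and dQ: "density S q' = Q"
    using density_RN_deriv_measure_plus[OF assms(1,2) setsPQ] by (simp_all add: S_def p'_def q'_def)
  have sf: "sigma_finite_measure P" "sigma_finite_measure Q"
    using assms(1,2) by (simp_all add: finite_measure.axioms)
  have "density R p = density R (\<lambda>y. ennreal (p y + q y) * p' y)"
    using dP P by (simp add: S density_density_eq)
  then have 1: "AE y in R. ennreal (p y) = ennreal (p y + q y) * p' y"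
    using sf P by (subst (asm) sigma_finite_density_unique) auto
  have "density R q = density R (\<lambda>y. ennreal (p y + q y) * q' y)"
    using dQ Q by (simp add: S density_density_eq)
  then have 2: "AE y in R. ennreal (q y) = ennreal (p y + q y) * q' y"
    using sf Q by (subst (asm) sigma_finite_density_unique) auto
  have "hellinger_integral \<alpha> P Q
      = (\<integral>y. enn2real (p' y) powr \<alpha> * enn2real (q' y) powr (1 - \<alpha>) \<partial>S)"
    by (simp add: hellinger_integral_def Let_def S_def p'_def q'_def)
  also have "\<dots> = (\<integral>y. (p y + q y) * (enn2real (p' y) powr \<alpha> * enn2real (q' y) powr (1 - \<alpha>)) \<partial>R)"
    unfolding S using nonneg by (subst integral_density) auto
  also have "\<dots> = (\<integral>y. p y powr \<alpha> * q y powr (1 - \<alpha>) \<partial>R)"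
  proof (rule integral_cong_AE)
    show "AE y in R. (p y + q y) * (enn2real (p' y) powr \<alpha> * enn2real (q' y) powr (1 - \<alpha>))
        = p y powr \<alpha> * q y powr (1 - \<alpha>)"
      using 1 2
    proof eventually_elim
      case (elim y)
      have "enn2real (ennreal (p y)) = enn2real (ennreal (p y + q y) * p' y)"
        "enn2real (ennreal (q y)) = enn2real (ennreal (p y + q y) * q' y)"
        using elim by simp_all
      then have eq: "p y = (p y + q y) * enn2real (p' y)" "q y = (p y + q y) * enn2real (q' y)"
        using nonneg[of y] by (simp_all add: enn2real_mult del: ennreal_plus)
      have "p y powr \<alpha> = (p y + q y) powr \<alpha> * enn2real (p' y) powr \<alpha>"
        using nonneg[of y] by (metis eq(1) powr_mult)
      moreover have "q y powr (1 - \<alpha>)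
          = (p y + q y) powr (1 - \<alpha>) * enn2real (q' y) powr (1 - \<alpha>)"
        using nonneg[of y] by (metis eq(2) powr_mult)
      ultimately have "p y powr \<alpha> * q y powr (1 - \<alpha>)
          = ((p y + q y) powr \<alpha> * (p y + q y) powr (1 - \<alpha>))
            * (enn2real (p' y) powr \<alpha> * enn2real (q' y) powr (1 - \<alpha>))"
        by (simp only: mult_ac)
      also have "(p y + q y) powr \<alpha> * (p y + q y) powr (1 - \<alpha>) = p y + q y"
        using nonneg[of y] by (simp flip: powr_add)
      finally show ?case by simp
    qed
  qed auto
  finally show ?thesis .
qed

end

theory Submission
  imports Defs
begin

text \<open>Only decoders with two values \<open>i\<close> and \<open>k\<close> are needed. Deciding \<open>i\<close> on \<open>A\<close> and \<open>k\<close> off \<open>A\<close>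
  errs with probability \<open>\<integral>\<^sub>A f\<^sub>i + \<integral>\<^bsub>-A\<^esub> f\<^sub>k\<close>, where \<open>f\<^sub>m\<close> is the density of the measure
  \<open>\<P>(X \<noteq> m, Y \<in> \<cdot>)\<close>, that is, the complementary prior of \<open>m\<close> times the complementary model of
  \<open>m\<close>. For \<open>A = {f\<^sub>i \<le> f\<^sub>k}\<close> this is \<open>\<integral> min f\<^sub>i f\<^sub>k \<le> \<integral> f\<^sub>i\<^sup>\<alpha> f\<^sub>k\<^sup>1\<^sup>-\<^sup>\<alpha>\<close>.\<close>

text \<open>The two exponents sum to 1, so the minimum is its own weighted geometric mean. Both
  exponents are nonnegative, so replacing the minimum by \<open>x\<close> in one factor and by
  \<open>y\<close> in the other can only increase the product.\<close>

lemma min_le_powr_mult_powr: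
  fixes x y \<alpha> :: real
  assumes "0 \<le> x" "0 \<le> y" "0 < \<alpha>" "\<alpha> < 1"
  shows "min x y \<le> x powr \<alpha> * y powr (1 - \<alpha>)"
proof -
  have "min x y = min x y powr \<alpha> * min x y powr (1 - \<alpha>)"
    using assms by (simp flip: powr_add)
  also have "\<dots> \<le> x powr \<alpha> * y powr (1 - \<alpha>)"
    using assms by (intro mult_mono powr_mono2) auto
  finally show ?thesis .
qed

text \<open>Carries error probabilities over to Bochner integrals, where they can be added and
  compared. Finiteness of \<open>P\<close> makes \<open>p\<close> integrable, so the Bochner
  integral agrees with the nonnegative one.\<close>

lemma measure_density_real:
  fixes p :: "'b \<Rightarrow> real"
  assumes "finite_measure P" and p: "p \<in> borel_measurable R" "\<And>y. 0 \<le> p y"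
    and P: "P = density R p" and A: "A \<in> sets R"
  shows "measure P A = (\<integral>y. indicator A y * p y \<partial>R)"
proof -
  have "integrable R (\<lambda>y. indicator A y * p y)"
    using integrable_of_finite_density[OF assms(1-4)] A
    by (rule integrable_mult_indicator[where 'b=real, simplified, rotated])
  then have "ennreal (\<integral>y. indicator A y * p y \<partial>R) = (\<integral>\<^sup>+ y. ennreal (indicator A y * p y) \<partial>R)"
    using p by (intro nn_integral_eq_integral[symmetric]) auto
  also have "\<dots> = emeasure P A"
    using p A by (simp add: P emeasure_density ennreal_mult' mult.commute ennreal_indicator)
  finally have "ennreal (\<integral>y. indicator A y * p y \<partial>R) = emeasure P A" .
  moreover have "0 \<le> (\<integral>y. indicator A y * p y \<partial>R)"
    using p by simp
  ultimately show ?thesis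
    by (metis enn2real_ennreal measure_def)
qed

text \<open>Densities with respect to the sum \<open>P + Q\<close> exist but take extended values.
  They are finite almost everywhere because \<open>P\<close> and \<open>Q\<close> are finite, so
  truncating them by \<open>enn2real\<close> leaves the measures unchanged.\<close>

lemma obtain_common_real_densities:
  assumes "finite_measure P" and "finite_measure Q" and "sets P = sets Q"
  obtains R :: "'b measure" and p q :: "'b \<Rightarrow> real"
    where "p \<in> borel_measurable R" "q \<in> borel_measurable R"
      "\<And>y. 0 \<le> p y" "\<And>y. 0 \<le> q y" "P = density R p" "Q = density R q"
proof -
  define R where "R = measure_plus P Q"
  interpret R: finite_measure R
    unfolding R_def by (rule finite_measure_measure_plus[OF assms])
  note d = density_RN_deriv_measure_plus[OF assms, folded R_def]
  have real: "density R (\<lambda>y. ennreal (enn2real (RN_deriv R S y))) = S"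
    if S: "finite_measure S" "density R (RN_deriv R S) = S" for S
  proof -
    have "absolutely_continuous R S"
      using absolutely_continuousI_density[of "RN_deriv R S" R] S(2) by simp
    moreover have "sets S = sets R"
      using S(2) sets_density[of R "RN_deriv R S"] by simp
    ultimately have "AE y in R. RN_deriv R S y \<noteq> \<infinity>"
      using S(1) by (intro R.RN_deriv_finite) (auto simp: finite_measure.axioms)
    then have "density R (\<lambda>y. ennreal (enn2real (RN_deriv R S y))) = density R (RN_deriv R S)"
      by (intro density_cong) (auto simp: less_top[symmetric])
    then show ?thesis using S(2) by simp
  qed
  show ?thesis
    by (rule that[of "\<lambda>y. enn2real (RN_deriv R P y)" R "\<lambda>y. enn2real (RN_deriv R Q y)"])
       (simp_all add: real assms d)
qed

text \<open>Finite measures suffice, so the total mass of the complementary models need not be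
  computed later. The weights \<open>a\<close> and \<open>c\<close> leave the integral through
  multiplicativity of \<open>powr\<close>.\<close>

lemma binary_test_error_bound:
  fixes a c \<alpha> :: real
  assumes "finite_measure P" and "finite_measure Q" and "sets P = sets Q"
    and ac: "0 \<le> a" "0 \<le> c" and \<alpha>: "0 < \<alpha>" "\<alpha> < 1"
  obtains A where "A \<in> sets P"
    "a * measure P A + c * measure Q (space P - A)
      \<le> a powr \<alpha> * c powr (1 - \<alpha>) * hellinger_integral \<alpha> P Q"
proof -
  obtain R :: "'a measure" and p q :: "'a \<Rightarrow> real" where
    pm [measurable]: "p \<in> borel_measurable R" and qm [measurable]: "q \<in> borel_measurable R"
    and p0: "\<And>y. 0 \<le> p y" and q0: "\<And>y. 0 \<le> q y" and P: "P = density R p" and Q: "Q = density R q"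
    using obtain_common_real_densities[OF assms(1-3)] by metis
  have ip: "integrable R p" and iq: "integrable R q"
    by (rule integrable_of_finite_density[OF assms(1) pm p0 P],
        rule integrable_of_finite_density[OF assms(2) qm q0 Q])
  \<comment> \<open>Each point is charged the smaller of the two weighted densities; ties go to
    \<open>A\<close>.\<close>
  define A where "A = {y \<in> space R. a * p y \<le> c * q y}"
  have A [measurable]: "A \<in> sets R"
    unfolding A_def by measurable
  have B [measurable]: "space R - A \<in> sets R"
    by simp
  have "a * measure P A + c * measure Q (space R - A)
      = (\<integral>y. a * (indicator A y * p y) \<partial>R) + (\<integral>y. c * (indicator (space R - A) y * q y) \<partial>R)"
    using measure_density_real[OF assms(1) pm p0 P A] measure_density_real[OF assms(2) qm q0 Q B]
    by simp
  also have "\<dots> = (\<integral>y. a * (indicator A y * p y) + c * (indicator (space R - A) y * q y) \<partial>R)"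
    using integrable_mult_indicator[OF A ip] integrable_mult_indicator[OF B iq]
    by (intro Bochner_Integration.integral_add[symmetric]) auto
  also have "\<dots> = (\<integral>y. min (a * p y) (c * q y) \<partial>R)"
    by (rule Bochner_Integration.integral_cong) (auto simp: A_def indicator_def)
  \<comment> \<open>A Bochner integral defaults to 0 on a non-integrable function, so monotonicity
    calls for integrability of both sides.\<close>
  also have "\<dots> \<le> (\<integral>y. (a powr \<alpha> * c powr (1 - \<alpha>)) * (p y powr \<alpha> * q y powr (1 - \<alpha>)) \<partial>R)"
  proof (rule integral_mono)
    show "integrable R (\<lambda>y. min (a * p y) (c * q y))"
      using ip iq by simp
    show "integrable R (\<lambda>y. (a powr \<alpha> * c powr (1 - \<alpha>)) * (p y powr \<alpha> * q y powr (1 - \<alpha>)))"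
      by (rule integrable_mult_right)
         (rule hellinger_integrand_integrable[OF assms(1,2) pm qm p0 q0 P Q \<alpha>])
    show "min (a * p y) (c * q y)
        \<le> (a powr \<alpha> * c powr (1 - \<alpha>)) * (p y powr \<alpha> * q y powr (1 - \<alpha>))" for y
      using min_le_powr_mult_powr[of "a * p y" "c * q y" \<alpha>] ac \<alpha> p0[of y] q0[of y]
      by (simp add: powr_mult mult_ac)
  qed
  also have "\<dots> = a powr \<alpha> * c powr (1 - \<alpha>) * hellinger_integral \<alpha> P Q"
    by (simp add: hellinger_integral_eq[OF assms(1,2) pm qm p0 q0 P Q])
  finally show ?thesis
    using A by (intro that[of A]) (simp_all add: P)
qed

text \<open>The factor \<open>\<alpha> - 1\<close> cancels the one in the divergence, and
  exponentiation undoes the logarithm. If the integral vanishes, the divergence is infinite and the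
  negative factor turns it into minus infinity, whose exponential is 0.\<close>

lemma exp_base_renyi_divergence:
  assumes "1 < b" "\<alpha> < 1"
  shows "exp_base b (ereal (\<alpha> - 1) * renyi_divergence b \<alpha> P Q) = ereal (hellinger_integral \<alpha> P Q)"
proof (cases "hellinger_integral \<alpha> P Q = 0")
  case True
  then have "ereal (\<alpha> - 1) * renyi_divergence b \<alpha> P Q = MInfty"
    using assms by (simp add: renyi_divergence_def)
  then show ?thesis
    using True by (simp only: exp_base.simps zero_ereal_def)
next
  case False
  moreover have "0 \<le> hellinger_integral \<alpha> P Q"
    by (simp add: hellinger_integral_def Let_def)
  ultimately show ?thesis
    using assms by (simp add: renyi_divergence_def)
qed

text \<open>The factor cancels the normalisation of the mixture. By the conditional law each summand
  is then the probability that \<open>X = j\<close> and \<open>Y\<close> lies in \<open>B\<close>,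
  and countable additivity also covers infinite \<open>M\<close>.\<close>

lemma emeasure_co_model:
  assumes \<Omega>: "prob_space \<Omega>" and X: "X \<in> \<Omega> \<rightarrow>\<^sub>M count_space (hypotheses M)" and Y: "Y \<in> \<Omega> \<rightarrow>\<^sub>M N"
    and P: "\<And>j. j \<in> hypotheses M \<Longrightarrow> prob_space (P j)"
    and sets_P: "\<And>j. j \<in> hypotheses M \<Longrightarrow> sets (P j) = sets N"
    and cond: "\<And>j B. j \<in> hypotheses M \<Longrightarrow> B \<in> sets N \<Longrightarrow>
           measure \<Omega> {\<omega> \<in> space \<Omega>. X \<omega> = j \<and> Y \<omega> \<in> B} = prior \<Omega> X j * measure (P j) B"
    and i: "prior \<Omega> X i < 1" and B: "B \<in> sets N"
  shows "ennreal (co_prior \<Omega> X i) * emeasure (co_model \<Omega> N M X P i) B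
    = emeasure \<Omega> {\<omega> \<in> space \<Omega>. X \<omega> \<noteq> i \<and> Y \<omega> \<in> B}"
proof -
  interpret \<Omega>: prob_space \<Omega> by fact
  define J where "J = hypotheses M - {i}"
  define E where "E j = {\<omega> \<in> space \<Omega>. X \<omega> = j \<and> Y \<omega> \<in> B}" for j
  have co: "0 < co_prior \<Omega> X i"
    using i by (simp add: co_prior_def)
  have E: "E j \<in> sets \<Omega>" if "j \<in> J" for j
  proof -
    have "E j = (X -` {j} \<inter> space \<Omega>) \<inter> (Y -` B \<inter> space \<Omega>)"
      by (auto simp: E_def)
    then show ?thesis
      using that measurable_sets[OF X, of "{j}"] measurable_sets[OF Y B] by (auto simp: J_def)
  qed
  have "ennreal (co_prior \<Omega> X i) * emeasure (co_model \<Omega> N M X P i) B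
      = (\<integral>\<^sup>+ j. ennreal (co_prior \<Omega> X i)
          * (ennreal (prior \<Omega> X j / co_prior \<Omega> X i) * emeasure (P j) B) \<partial>count_space J)"
    unfolding co_model_def J_def
    by (subst emeasure_weighted_sum) (auto simp: sets_P B nn_integral_cmult)
  also have "\<dots> = (\<integral>\<^sup>+ j. emeasure \<Omega> (E j) \<partial>count_space J)"
  proof (rule nn_integral_cong)
    fix j assume "j \<in> space (count_space J)"
    then have j: "j \<in> hypotheses M" by (simp add: J_def)
    interpret Pj: prob_space "P j" by (rule P[OF j])
    have "ennreal (co_prior \<Omega> X i) * (ennreal (prior \<Omega> X j / co_prior \<Omega> X i) * emeasure (P j) B)
        = ennreal (co_prior \<Omega> X i * (prior \<Omega> X j / co_prior \<Omega> X i * measure (P j) B))"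
      using co by (simp add: Pj.emeasure_eq_measure prior_def flip: ennreal_mult')
    also have "\<dots> = ennreal (measure \<Omega> (E j))"
      using co cond[OF j B] by (simp add: E_def)
    finally show "ennreal (co_prior \<Omega> X i) * (ennreal (prior \<Omega> X j / co_prior \<Omega> X i) * emeasure (P j) B)
        = emeasure \<Omega> (E j)"
      by (simp add: \<Omega>.emeasure_eq_measure)
  qed
  also have "\<dots> = emeasure \<Omega> (\<Union>j\<in>J. E j)"
    using E by (intro emeasure_UN_countable[symmetric]) (auto simp: disjoint_family_on_def E_def)
  \<comment> \<open>\<open>X\<close> takes its values in \<open>hypotheses M\<close>, so differing
    from \<open>i\<close> means lying in \<open>J\<close>.\<close>
  also have "(\<Union>j\<in>J. E j) = {\<omega> \<in> space \<Omega>. X \<omega> \<noteq> i \<and> Y \<omega> \<in> B}"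
    using measurable_space[OF X] by (auto simp: E_def J_def)
  finally show ?thesis .
qed

lemma min_error_prob_le:
  assumes "L \<in> N \<rightarrow>\<^sub>M count_space (hypotheses M)"
  shows "min_error_prob \<Omega> N M X Y \<le> measure \<Omega> {\<omega> \<in> space \<Omega>. X \<omega> \<noteq> L (Y \<omega>)}"
  \<comment> \<open>A real infimum is a lower bound only of a set that is bounded below; here 0
    bounds the probabilities.\<close>
  unfolding min_error_prob_def by (rule cINF_lower[OF bdd_belowI2[where m=0] assms]) simp

theorem theorem13:
  fixes b :: real and M :: enat
    and \<Omega> :: "'a measure" and N :: "'b measure"
    and X :: "'a \<Rightarrow> nat" and Y :: "'a \<Rightarrow> 'b" and P :: "nat \<Rightarrow> 'b measure"
  assumes "1 < b"
    and "2 \<le> M"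
    and "prob_space \<Omega>"
    and "X \<in> \<Omega> \<rightarrow>\<^sub>M count_space (hypotheses M)"
    and "Y \<in> \<Omega> \<rightarrow>\<^sub>M N"
    and "\<And>i. i \<in> hypotheses M \<Longrightarrow> prob_space (P i)"
    and "\<And>i. i \<in> hypotheses M \<Longrightarrow> sets (P i) = sets N"
    and "\<And>i B. i \<in> hypotheses M \<Longrightarrow> B \<in> sets N \<Longrightarrow>
           measure \<Omega> {\<omega> \<in> space \<Omega>. X \<omega> = i \<and> Y \<omega> \<in> B} = prior \<Omega> X i * measure (P i) B"
    and "\<And>i. i \<in> hypotheses M \<Longrightarrow> prior \<Omega> X i < 1"
  shows "ereal (min_error_prob \<Omega> N M X Y) \<le>
    (INF (i, k) \<in> {(i, k). i \<in> hypotheses M \<and> k \<in> hypotheses M \<and> i \<noteq> k}.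
       INF \<alpha> \<in> {0<..<1}.
         ereal (co_prior \<Omega> X i powr \<alpha>) * ereal (co_prior \<Omega> X k powr (1 - \<alpha>)) *
         exp_base b (ereal (\<alpha> - 1) *
           renyi_divergence b \<alpha> (co_model \<Omega> N M X P i) (co_model \<Omega> N M X P k)))"
proof (rule INF_greatest, clarify, rule INF_greatest)
  fix i k :: nat and \<alpha> :: real
  assume i: "i \<in> hypotheses M" and k: "k \<in> hypotheses M" and "\<alpha> \<in> {0<..<1}"
  then have \<alpha>: "0 < \<alpha>" "\<alpha> < 1" by auto
  interpret \<Omega>: prob_space \<Omega> by fact
  note Y = assms(5)
  have co: "0 < co_prior \<Omega> X m" if "m \<in> hypotheses M" for m
    using assms(9)[OF that] by (simp add: co_prior_def)
  let ?Q = "co_model \<Omega> N M X P"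
  have emeasure_Q: "ennreal (co_prior \<Omega> X m) * emeasure (?Q m) B
      = emeasure \<Omega> {\<omega> \<in> space \<Omega>. X \<omega> \<noteq> m \<and> Y \<omega> \<in> B}"
    if "m \<in> hypotheses M" "B \<in> sets N" for m B
    by (rule emeasure_co_model[OF assms(3-8) assms(9)[OF that(1)] that(2)])
  \<comment> \<open>A positive multiple of the total mass is a probability, so the mass is
    finite.\<close>
  have Q_finite: "finite_measure (?Q m)" if m: "m \<in> hypotheses M" for m
  proof (rule finite_measureI)
    have "ennreal (co_prior \<Omega> X m) * emeasure (?Q m) (space N) \<noteq> \<infinity>"
      using emeasure_Q[OF m sets.top] by simp
    then show "emeasure (?Q m) (space (?Q m)) \<noteq> \<infinity>"
      using co[OF m] by (auto simp: co_model_def ennreal_mult_eq_top_iff)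
  qed
  have measure_Q: "co_prior \<Omega> X m * measure (?Q m) B
      = measure \<Omega> {\<omega> \<in> space \<Omega>. X \<omega> \<noteq> m \<and> Y \<omega> \<in> B}"
    if "m \<in> hypotheses M" "B \<in> sets N" for m B
    using arg_cong[OF emeasure_Q[OF that], of enn2real] co[OF that(1)]
    by (simp add: enn2real_mult measure_def)
  have sets_eq: "sets (?Q i) = sets (?Q k)"
    by (simp add: co_model_def)
  obtain A where "A \<in> sets (?Q i)"
    and bound: "co_prior \<Omega> X i * measure (?Q i) A + co_prior \<Omega> X k * measure (?Q k) (space (?Q i) - A)
      \<le> co_prior \<Omega> X i powr \<alpha> * co_prior \<Omega> X k powr (1 - \<alpha>) * hellinger_integral \<alpha> (?Q i) (?Q k)"
    using binary_test_error_bound[OF Q_finite[OF i] Q_finite[OF k] sets_eq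
        less_imp_le[OF co[OF i]] less_imp_le[OF co[OF k]] \<alpha>] by blast
  then have A: "A \<in> sets N" and Ac: "space N - A \<in> sets N"
    by (auto simp: co_model_def)
  \<comment> \<open>Both values are hypotheses, so this two-valued rule competes in the
    infimum.\<close>
  have L: "(\<lambda>y. if y \<in> A then i else k) \<in> N \<rightarrow>\<^sub>M count_space (hypotheses M)"
    using A i k by (intro measurable_If_set) auto
  have events: "{\<omega> \<in> space \<Omega>. X \<omega> \<noteq> m \<and> Y \<omega> \<in> B} \<in> sets \<Omega>" if B: "B \<in> sets N" for m B
  proof -
    have "{\<omega> \<in> space \<Omega>. X \<omega> \<noteq> m \<and> Y \<omega> \<in> B}
        = (X -` (hypotheses M - {m}) \<inter> space \<Omega>) \<inter> (Y -` B \<inter> space \<Omega>)"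
      using measurable_space[OF assms(4)] by auto
    then show ?thesis
      using measurable_sets[OF assms(4), of "hypotheses M - {m}"] measurable_sets[OF Y B] by auto
  qed
  have "min_error_prob \<Omega> N M X Y \<le> measure \<Omega> {\<omega> \<in> space \<Omega>. X \<omega> \<noteq> (if Y \<omega> \<in> A then i else k)}"
    by (rule min_error_prob_le[OF L])
  \<comment> \<open>On \<open>A\<close> the rule errs when \<open>X\<close> differs from
    \<open>i\<close>, off \<open>A\<close> when it differs from \<open>k\<close>. \<open>Y\<close>
    stays in \<open>space N\<close>, so the complement is taken there.\<close>
  also have "{\<omega> \<in> space \<Omega>. X \<omega> \<noteq> (if Y \<omega> \<in> A then i else k)}
      = {\<omega> \<in> space \<Omega>. X \<omega> \<noteq> i \<and> Y \<omega> \<in> A} \<union> {\<omega> \<in> space \<Omega>. X \<omega> \<noteq> k \<and> Y \<omega> \<in> space N - A}"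
    using measurable_space[OF Y] by auto
  also have "measure \<Omega> \<dots> = co_prior \<Omega> X i * measure (?Q i) A
      + co_prior \<Omega> X k * measure (?Q k) (space N - A)"
    unfolding measure_Q[OF i A] measure_Q[OF k Ac]
    by (rule \<Omega>.finite_measure_Union[OF events[OF A] events[OF Ac]]) auto
  also have "\<dots> \<le> co_prior \<Omega> X i powr \<alpha> * co_prior \<Omega> X k powr (1 - \<alpha>)
      * hellinger_integral \<alpha> (?Q i) (?Q k)"
    using bound by (simp add: co_model_def)
  finally show "ereal (min_error_prob \<Omega> N M X Y) \<le>
      ereal (co_prior \<Omega> X i powr \<alpha>) * ereal (co_prior \<Omega> X k powr (1 - \<alpha>)) *
      exp_base b (ereal (\<alpha> - 1) * renyi_divergence b \<alpha> (?Q i) (?Q k))"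
    by (simp add: exp_base_renyi_divergence[OF assms(1) \<alpha>(2)])
qed

end
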